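(* Let $\mathcal X$ be a separable normed space over $\mathbb F$ with $\dim\mathcal X>1$, let $T$ be a weakly l-sequentially supercyclic bounded linear operator on $\mathcal X$, and let $y\in Y_T$ be arbitrary, where $Y_T$ is the set of all weakly l-sequentially supercyclic vectors for $T$. (a) If there exists $f_0\in\mathcal X^*$ such that $\liminf_n|f_0(T^ny)|>0$, then for every $x\in\mathcal X$ there exist a bounded sequence of scalars $\{\alpha_j(x)\}_{j\ge0}$ and a sequence $\{T^{n_j(x)}\}_{j\ge0}$ with entries from $\{T^n\}_{n\ge0}$ (neither depending on $f$) such that $\alpha_j(x)f(T^{n_j(x)}y)\to f(x)$ for every $f\in\mathcal X^*$. (b) If for some $x\in\mathcal X$ there exist a bounded scalar sequence $\{\alpha_j(x)\}_{j\ge0}$ and a sequence $\{T^{n_j(x)}\}_{j\ge0}$ with entries from $\{T^n\}_{n\ge0}$ such that $\alpha_j(x)f(T^{n_j(x)}y)\to f(x)$ for every $f\in\mathcal X^*$, then there exist a convergent scalar sequence $\{\alpha_k(x)\}_{k\ge0}$ and a sequence $\{T^{n_k(x)}\}_{k\ge0}$ with entries from $\{T^n\}_{n\ge0}$ such that $\alpha_k(x)f(T^{n_k(x)}y)\to f(x)$ for every $f\in\mathcal X^*$. (c) Suppose $T$ is power bounded. If for some nonzero $x\in\mathcal X$ there exist a convergent sequence of scalars $\{\alpha_k(x)\}_{k\ge0}$, say $\lim_k\alpha_k(x)=\alpha(x)\in\mathbb F$, and a sequence $\{T^{n_k(x)}\}_{k\ge0}$ with entries from $\{T^n\}_{n\ge0}$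 for which $\lim_k\alpha_k(x)f(T^{n_k(x)}y)=f(x)$ for every $f\in\mathcal X^*$, then $\alpha(x)\ne0$ and $\alpha(x)\lim_kf(T^{n_k(x)}y)=f(x)$ for every $f\in\mathcal X^*$. (d) Suppose there is a (not necessarily linear) functional $\alpha:\mathcal X\to\mathbb F$ such that $\alpha(x)\ne0$ whenever $x\ne0$ and, for each $x\in\mathcal X$, there is a sequence $\{T^{n_k(x)}\}_{k\ge0}$ with entries from $\{T^n\}_{n\ge0}$ such that $\alpha(x)\lim_kf(T^{n_k(x)}y)=f(x)$ for every $f\in\mathcal X^*$. Then $\liminf_n|f(T^ny)|=0$ for every $f\in\mathcal X^*$.
   Context: $\mathbb F$ is $\mathbb R$ or $\mathbb C$; $\mathcal X^*$ is the (topological) dual of the normed space $\mathcal X$ (not assumed complete). A bounded linear operator $T:\mathcal X\to\mathcal X$ is power bounded if $\sup_{n\ge0}\|T^n\|<\infty$. The projective orbit of a nonzero vector $y$ under $T$ is $\mathcal O_T([y])=\{\alpha T^ny:\alpha\in\mathbb F,\ n\ge0 \text{ an integer}\}$. The weak limit set $A^{-wl}$ of $A\subseteq\mathcal X$ is the set of all weak limits of weakly convergent $A$-valued sequences. A nonzero $y\in\mathcal X$ is a weakly l-sequentially supercyclic vector for $T$ if $\mathcal O_T([y])^{-wl}=\mathcal X$, i.e., for every $x\in\mathcal X$ there are scalars $\alpha_k$ and nonnegative integers $n_k$ (depending on $x$) such that $\alpha_kT^{n_k}y\to x$ weakly. $T$ is weakly l-sequentially supercyclic if $Y_T\ne\varnothing$,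 where $Y_T=\{y\in\mathcal X:\mathcal O_T([y])^{-wl}=\mathcal X\}$. Conventions: a sequence $\{T^{n_k}\}_{k\ge0}$ "with entries from $\{T^n\}_{n\ge0}$" is one given by nonnegative integers $n_k$. If $x\in\mathcal O_T([y])$ it may be constant; if $x\notin\mathcal O_T([y])$ it is understood to be a subsequence of $\{T^n\}_{n\ge0}$, i.e., $n_k$ is strictly increasing. The scalars $\alpha_k(x)$ in such approximating sequences are taken to be nonzero whenever $x\ne0$. *)

theory Defs
  imports "HOL-Analysis.Analysis"
begin

text \<open>
  The scalar field is isometrically isomorphic, as a normed field, to the reals or to the
  complex numbers.
\<close>

class real_or_complex = real_normed_field +
  assumes real_or_complex:
    "(\<exists>\<phi> :: 'a \<Rightarrow> real. bij \<phi> \<and> (\<forall>a b. \<phi> (a + b) = \<phi> a + \<phi> b)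
        \<and> (\<forall>a b. \<phi> (a * b) = \<phi> a * \<phi> b) \<and> (\<forall>a. norm (\<phi> a) = norm a))
   \<or> (\<exists>\<phi> :: 'a \<Rightarrow> complex. bij \<phi> \<and> (\<forall>a b. \<phi> (a + b) = \<phi> a + \<phi> b)
        \<and> (\<forall>a b. \<phi> (a * b) = \<phi> a * \<phi> b) \<and> (\<forall>a. norm (\<phi> a) = norm a))"

instance real :: real_or_complex
  by standard (rule disjI1, rule exI[of _ id], simp)

instance complex :: real_or_complex
  by standard (rule disjI2, rule exI[of _ id], simp)

text \<open>
  A normed space over the scalar field \<open>'f\<close>. Its additive group and its norm are those of the type
  class \<open>real_normed_vector\<close>; the last assumption says that the real scalar multiplication of that
  class is the restriction of \<open>smul\<close>.
\<close>

locale normed_space_over = vector_space smul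
  for smul :: "'f::real_or_complex \<Rightarrow> 'a::real_normed_vector \<Rightarrow> 'a" +
  assumes norm_smul: "norm (smul c x) = norm c * norm x"
    and smul_of_real: "smul (of_real r) x = r *\<^sub>R x"

text \<open>
  \<open>vector_space.dim\<close> is a natural number and is 0 in infinite dimension, so the Hamel dimension
  is compared with 1 through a basis.
\<close>

definition dim_gt_1 :: "('f::real_or_complex \<Rightarrow> 'a::real_normed_vector \<Rightarrow> 'a) \<Rightarrow> bool" where
  "dim_gt_1 smul \<longleftrightarrow>
    (\<exists>B. \<not> module.dependent smul B \<and> module.span smul B = UNIV \<and> (infinite B \<or> card B > 1))"

text \<open>\<open>bounded_linear\<close> by itself only gives linearity over the reals.\<close>

definition bounded_operator ::
  "('f::real_or_complex \<Rightarrow> 'a::real_normed_vector \<Rightarrow> 'a) \<Rightarrow> ('a \<Rightarrow> 'a) \<Rightarrow> bool" where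
  "bounded_operator smul T \<longleftrightarrow> Vector_Spaces.linear smul smul T \<and> bounded_linear T"

definition dual_space ::
  "('f::real_or_complex \<Rightarrow> 'a::real_normed_vector \<Rightarrow> 'a) \<Rightarrow> ('a \<Rightarrow> 'f) set" where
  "dual_space smul = {f. Vector_Spaces.linear smul (*) f \<and> bounded_linear f}"

definition power_bounded :: "('a::real_normed_vector \<Rightarrow> 'a) \<Rightarrow> bool" where
  "power_bounded T \<longleftrightarrow> bdd_above (range (\<lambda>n. onorm (T ^^ n)))"

definition weakly_converges ::
  "('f::real_or_complex \<Rightarrow> 'a::real_normed_vector \<Rightarrow> 'a) \<Rightarrow> (nat \<Rightarrow> 'a) \<Rightarrow> 'a \<Rightarrow> bool" where
  "weakly_converges smul u x \<longleftrightarrow> (\<forall>f\<in>dual_space smul. (\<lambda>k. f (u k)) \<longlonglongrightarrow> f x)"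

definition weak_limit_set ::
  "('f::real_or_complex \<Rightarrow> 'a::real_normed_vector \<Rightarrow> 'a) \<Rightarrow> 'a set \<Rightarrow> 'a set" where
  "weak_limit_set smul A = {x. \<exists>u. range u \<subseteq> A \<and> weakly_converges smul u x}"

definition projective_orbit ::
  "('f::real_or_complex \<Rightarrow> 'a::real_normed_vector \<Rightarrow> 'a) \<Rightarrow> ('a \<Rightarrow> 'a) \<Rightarrow> 'a \<Rightarrow> 'a set" where
  "projective_orbit smul T y = {smul \<alpha> ((T ^^ n) y) | \<alpha> n. True}"

definition wl_supercyclic_vectors ::
  "('f::real_or_complex \<Rightarrow> 'a::real_normed_vector \<Rightarrow> 'a) \<Rightarrow> ('a \<Rightarrow> 'a) \<Rightarrow> 'a set" where
  "wl_supercyclic_vectors smul T =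
    {y. y \<noteq> 0 \<and> weak_limit_set smul (projective_orbit smul T y) = UNIV}"

definition wl_supercyclic ::
  "('f::real_or_complex \<Rightarrow> 'a::real_normed_vector \<Rightarrow> 'a) \<Rightarrow> ('a \<Rightarrow> 'a) \<Rightarrow> bool" where
  "wl_supercyclic smul T \<longleftrightarrow> wl_supercyclic_vectors smul T \<noteq> {}"

text \<open>
  The exponents of a sequence \<open>T ^^ n k\<close> used to reach \<open>x\<close> are arbitrary natural numbers when \<open>x\<close>
  lies in the projective orbit of \<open>y\<close>; otherwise the sequence has to be a subsequence of the powers
  of \<open>T\<close>.
\<close>

definition admissible_exponents ::
  "('f::real_or_complex \<Rightarrow> 'a::real_normed_vector \<Rightarrow> 'a) \<Rightarrow> ('a \<Rightarrow> 'a) \<Rightarrow> 'a \<Rightarrow> 'a \<Rightarrow>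
    (nat \<Rightarrow> nat) \<Rightarrow> bool" where
  "admissible_exponents smul T y x n \<longleftrightarrow> x \<in> projective_orbit smul T y \<or> strict_mono n"

text \<open>By convention the scalars approximating a nonzero vector are themselves nonzero.\<close>

definition approximates ::
  "('f::real_or_complex \<Rightarrow> 'a::real_normed_vector \<Rightarrow> 'a) \<Rightarrow> ('a \<Rightarrow> 'a) \<Rightarrow> 'a \<Rightarrow> 'a \<Rightarrow>
    (nat \<Rightarrow> 'f) \<Rightarrow> (nat \<Rightarrow> nat) \<Rightarrow> bool" where
  "approximates smul T y x \<alpha> n \<longleftrightarrow>
    admissible_exponents smul T y x n \<and> (x \<noteq> 0 \<longrightarrow> (\<forall>k. \<alpha> k \<noteq> 0)) \<and>
    (\<forall>f\<in>dual_space smul. (\<lambda>k. \<alpha> k * f ((T ^^ n k) y)) \<longlonglongrightarrow> f x)"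

end

theory Submission
  imports Defs
begin

text \<open>
  By the Hahn--Banach theorem the dual separates points. Hence a vector that is the weak limit of
  multiples of finitely many \<open>T\<^sup>n y\<close> lies in the projective orbit, and outside the orbit the exponents
  may be taken strictly increasing. A functional \<open>f\<^sub>0\<close> that stays away from 0 along the orbit then
  bounds the scalars (a), Bolzano--Weierstrass makes them converge (b), and if \<open>T\<close> is power bounded
  their limit cannot vanish, since some functional is nonzero at \<open>x\<close> (c). Part (d) applies its
  hypothesis to a nonzero vector in the kernel of \<open>f \<circ> T\<^sup>N\<close>: if \<open>f\<close> stayed away from 0 on \<open>T\<^sup>n y\<close> for
  \<open>n \<ge> N\<close>, then \<open>f \<circ> T\<^sup>N\<close> would stay away from 0 on the whole orbit, so that it is irrelevant whether
  the kernel vector belongs to the projective orbit.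

  The Hahn--Banach theorem is proved without extending functionals from subspaces: the functional is
  a minimal sublinear functional, and minimality forces linearity because every sublinear \<open>p\<close> dominates
  the sublinear functional \<open>x \<mapsto> inf\<^sub>t (p (x + t z) - t p z)\<close>, \<open>t \<ge> 0\<close>, whose value at \<open>- z\<close> is at
  most \<open>- p z\<close>.
\<close>

section \<open>Sublinear functionals and the Hahn--Banach theorem\<close>

text \<open>Homogeneity is stated as an inequality for positive factors only, which is convenient to
  check for an infimum; equality follows by rescaling with \<open>inverse c\<close>.\<close>

definition sublinear :: "('a::real_vector \<Rightarrow> real) \<Rightarrow> bool" where
  "sublinear p \<longleftrightarrow> (\<forall>x y. p (x + y) \<le> p x + p y) \<and> (\<forall>c x. 0 < c \<longrightarrow> p (c *\<^sub>R x) \<le> c * p x)"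

lemma sublinear_add: "sublinear p \<Longrightarrow> p (x + y) \<le> p x + p y"
  and sublinear_scaleR_le: "sublinear p \<Longrightarrow> 0 < c \<Longrightarrow> p (c *\<^sub>R x) \<le> c * p x"
  by (auto simp: sublinear_def)

lemma sublinear_scaleR:
  assumes "sublinear p" "0 < c"
  shows "p (c *\<^sub>R x) = c * p x"
proof (rule antisym)
  show "p (c *\<^sub>R x) \<le> c * p x"
    using assms by (rule sublinear_scaleR_le)
  have "p (inverse c *\<^sub>R c *\<^sub>R x) \<le> inverse c * p (c *\<^sub>R x)"
    using assms by (intro sublinear_scaleR_le) auto
  then show "c * p x \<le> p (c *\<^sub>R x)"
    using assms by (simp add: field_simps)
qed

lemma sublinear_zero:
  assumes "sublinear p"
  shows "p 0 = 0"
  using sublinear_scaleR[OF assms, of 2 0] by simp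

lemma sublinear_ge_minus:
  assumes "sublinear p"
  shows "- p (- x) \<le> p x"
  using sublinear_add[OF assms, of x "- x"] sublinear_zero[OF assms] by simp

text \<open>Subadditivity comes from adding the parameters \<open>t\<close> and \<open>s\<close>,
  homogeneity from rescaling \<open>t\<close> to \<open>c * t\<close>. The result serves twice: for
  oddness of a minimal functional, and to start below the norm when a functional nonzero at a given
  vector is sought.\<close>

lemma sublinear_directional:
  fixes p :: "'a::real_vector \<Rightarrow> real"
  assumes p: "sublinear p"
  obtains q where "sublinear q" "q \<le> p" "q (- z) \<le> - p z"
proof -
  define h where "h x t = p (x + t *\<^sub>R z) - t * p z" for x t
  define q where "q x = (INF t\<in>{0..}. h x t)" for x
  \<comment> \<open>A lower bound independent of \<open>t\<close>, so that the infimum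
    \<open>q x\<close> is finite.\<close>
  have low: "- p (- x) \<le> h x t" if "0 \<le> t" for x t
  proof -
    have "t * p z = p (t *\<^sub>R z)"
      using that sublinear_scaleR[OF p] sublinear_zero[OF p] by (cases "t = 0") auto
    also have "\<dots> \<le> p (x + t *\<^sub>R z) + p (- x)"
      using sublinear_add[OF p, of "x + t *\<^sub>R z" "- x"] by simp
    finally show ?thesis
      by (simp add: h_def)
  qed
  have q_le: "q x \<le> h x t" if "0 \<le> t" for x t
    unfolding q_def using that low
    by (intro cINF_lower bdd_belowI2[where m = "- p (- x)"]) auto
  have le_q: "m \<le> q x" if "\<And>t. 0 \<le> t \<Longrightarrow> m \<le> h x t" for m x
    unfolding q_def using that by (intro cINF_greatest) auto
  have "q (x + x') \<le> q x + q x'" for x x'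
  proof -
    have "q (x + x') - h x t \<le> h x' s" if "0 \<le> t" "0 \<le> s" for t s
    proof -
      have "q (x + x') \<le> h (x + x') (t + s)"
        using that by (intro q_le) auto
      also have "\<dots> \<le> h x t + h x' s"
        using sublinear_add[OF p, of "x + t *\<^sub>R z" "x' + s *\<^sub>R z"]
        by (simp add: h_def algebra_simps)
      finally show ?thesis
        by simp
    qed
    then have "q (x + x') - h x t \<le> q x'" if "0 \<le> t" for t
      using that by (intro le_q)
    then have "q (x + x') - q x' \<le> q x"
      by (intro le_q) (simp add: algebra_simps)
    then show ?thesis
      by simp
  qed
  moreover have "q (c *\<^sub>R x) \<le> c * q x" if "0 < c" for c x
  proof -
    have "q (c *\<^sub>R x) / c \<le> h x t" if "0 \<le> t" for t
    proof -
      have "q (c *\<^sub>R x) \<le> h (c *\<^sub>R x) (c * t)"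
        using that \<open>0 < c\<close> by (intro q_le) auto
      also have "\<dots> = c * h x t"
        using sublinear_scaleR[OF p \<open>0 < c\<close>, of "x + t *\<^sub>R z"]
        by (simp add: h_def algebra_simps)
      finally show ?thesis
        using \<open>0 < c\<close> by (simp add: field_simps)
    qed
    then have "q (c *\<^sub>R x) / c \<le> q x"
      by (rule le_q)
    then show ?thesis
      using that by (simp add: field_simps)
  qed
  ultimately have "sublinear q"
    by (simp add: sublinear_def)
  \<comment> \<open>The parameter \<open>t = 0\<close> gives domination by \<open>p\<close>;
    \<open>t = 1\<close> cancels \<open>- z\<close> against \<open>z\<close> and leaves
    \<open>p 0 - p z\<close>.\<close>
  moreover have "q \<le> p"
    using q_le[of 0] by (simp add: le_fun_def h_def)
  moreover have "q (- z) \<le> - p z"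
    using q_le[of 1 "- z"] by (simp add: h_def sublinear_zero[OF p])
  ultimately show thesis
    by (rule that)
qed

text \<open>Supplies the lower bounds for Zorn's lemma: a pointwise infimum, finite because every
  member is at most \<open>q\<close> and hence at least \<open>- q (- x)\<close> at
  \<open>x\<close>. Subadditivity uses that any two members lie above a single member of the
  chain.\<close>

lemma sublinear_Inf_chain:
  fixes C :: "('a::real_vector \<Rightarrow> real) set"
  assumes "C \<noteq> {}" and sub: "\<And>p. p \<in> C \<Longrightarrow> sublinear p" and le: "\<And>p. p \<in> C \<Longrightarrow> p \<le> q"
    and chain: "\<And>p p'. p \<in> C \<Longrightarrow> p' \<in> C \<Longrightarrow> p \<le> p' \<or> p' \<le> p"
  obtains r where "sublinear r" "\<And>p. p \<in> C \<Longrightarrow> r \<le> p"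
proof
  define r where "r x = (INF p\<in>C. p x)" for x
  have low: "- q (- x) \<le> p x" if "p \<in> C" for p x
  proof -
    have "- q (- x) \<le> - p (- x)"
      using le[OF that] by (simp add: le_fun_def)
    then show ?thesis
      using sublinear_ge_minus[OF sub[OF that], of x] by linarith
  qed
  have r_le: "r x \<le> p x" if "p \<in> C" for p x
    unfolding r_def using that low
    by (intro cINF_lower bdd_belowI2[where m = "- q (- x)"]) auto
  have le_r: "m \<le> r x" if "\<And>p. p \<in> C \<Longrightarrow> m \<le> p x" for m x
    unfolding r_def using that \<open>C \<noteq> {}\<close> by (intro cINF_greatest) auto
  show "r \<le> p" if "p \<in> C" for p
    using r_le[OF that] by (simp add: le_fun_def)
  have "r (x + y) \<le> r x + r y" for x y
  proof -
    have "r (x + y) - p x \<le> p' y" if C: "p \<in> C" "p' \<in> C" for p p'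
    proof -
      obtain p'' where "p'' \<in> C" "p'' \<le> p" "p'' \<le> p'"
        using chain[OF C] C by blast
      then have "r (x + y) \<le> p'' x + p'' y" "p'' x \<le> p x" "p'' y \<le> p' y"
        using r_le[of p'' "x + y"] sublinear_add[OF sub, of p'' x y] by (auto simp: le_fun_def)
      then show ?thesis
        by linarith
    qed
    then have "r (x + y) - p x \<le> r y" if "p \<in> C" for p
      using that by (intro le_r)
    then have "r (x + y) - r y \<le> r x"
      by (intro le_r) (simp add: algebra_simps)
    then show ?thesis
      by simp
  qed
  moreover have "r (c *\<^sub>R x) \<le> c * r x" if "0 < c" for c x
  proof -
    have "r (c *\<^sub>R x) / c \<le> p x" if "p \<in> C" for p
      using r_le[OF that, of "c *\<^sub>R x"] sublinear_scaleR[OF sub[OF that] \<open>0 < c\<close>, of x] \<open>0 < c\<close>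
      by (simp add: field_simps)
    then have "r (c *\<^sub>R x) / c \<le> r x"
      by (rule le_r)
    then show ?thesis
      using that by (simp add: field_simps)
  qed
  ultimately show "sublinear r"
    by (simp add: sublinear_def)
qed

text \<open>Minimality makes the functional of \<open>sublinear_directional\<close> equal to
  \<open>p\<close>, whence \<open>p\<close> is odd; oddness turns subadditivity into additivity and
  extends homogeneity to negative factors.\<close>

lemma minimal_sublinear_is_linear:
  fixes p :: "'a::real_vector \<Rightarrow> real"
  assumes p: "sublinear p" and min: "\<And>q. sublinear q \<Longrightarrow> q \<le> p \<Longrightarrow> q = p"
  shows "linear p"
proof -
  have neg: "p (- z) = - p z" for z
  proof -
    obtain q where "sublinear q" "q \<le> p" "q (- z) \<le> - p z"
      using sublinear_directional[OF p] .
    then show ?thesis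
      using min sublinear_ge_minus[OF p, of z] by fastforce
  qed
  have add: "p (x + y) = p x + p y" for x y
    using sublinear_add[OF p, of x y] sublinear_add[OF p, of "x + y" "- y"] neg[of y] by simp
  have "p (c *\<^sub>R x) = c * p x" for c x
  proof (cases c "0::real" rule: linorder_cases)
    case less
    then show ?thesis
      using sublinear_scaleR[OF p, of "- c" x] neg[of "c *\<^sub>R x"] by simp
  qed (simp_all add: sublinear_zero[OF p] sublinear_scaleR[OF p])
  then show ?thesis
    using add by (intro linearI) auto
qed

theorem Hahn_Banach_sublinear:
  fixes q :: "'a::real_vector \<Rightarrow> real"
  assumes q: "sublinear q"
  obtains u where "linear u" "u \<le> q"
proof -
  define A where "A = {p. sublinear p \<and> p \<le> q}"
  \<comment> \<open>The order is reversed, so that the maximal element given by Zorn's lemma is a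
    minimal functional in \<open>A\<close>.\<close>
  define R where "R = relation_of (\<lambda>p p'. p' \<le> p) A"
  have "partial_order_on A R"
    unfolding R_def by (rule partial_order_on_relation_ofI) auto
  moreover have "\<exists>r\<in>A. \<forall>p\<in>C. r \<le> p" if C: "C \<in> Chains R" for C
  proof (cases "C = {}")
    case True
    then show ?thesis
      using q by (auto simp: A_def)
  next
    case False
    have chain: "p \<le> p' \<or> p' \<le> p" if "p \<in> C" "p' \<in> C" for p p'
      using C that by (auto simp: Chains_def R_def relation_of_def)
    have "C \<subseteq> A"
      using C by (auto simp: Chains_def R_def relation_of_def)
    then obtain r where "sublinear r" "\<And>p. p \<in> C \<Longrightarrow> r \<le> p"
      using sublinear_Inf_chain[OF False, of q] chain unfolding A_def by blast
    moreover have "r \<le> q"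
      using False \<open>C \<subseteq> A\<close> \<open>\<And>p. p \<in> C \<Longrightarrow> r \<le> p\<close> order_trans unfolding A_def by blast
    ultimately show ?thesis
      by (auto simp: A_def)
  qed
  ultimately obtain u where u: "u \<in> A" and min: "\<And>p. p \<in> A \<Longrightarrow> p \<le> u \<Longrightarrow> p = u"
    unfolding R_def using predicate_Zorn[of A "\<lambda>p p'. p' \<le> p"] by blast
  have "linear u"
  proof (rule minimal_sublinear_is_linear)
    show "p = u" if "sublinear p" "p \<le> u" for p
      using that u by (intro min) (auto simp: A_def intro: order_trans)
  qed (use u in \<open>simp add: A_def\<close>)
  with u show thesis
    by (intro that) (auto simp: A_def)
qed

text \<open>A linear functional dominated by the norm could vanish at \<open>x\<close>, so it is
  taken below a functional \<open>q\<close> with \<open>q (- x) \<le> - norm x\<close>; this forces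
  \<open>u x \<ge> norm x > 0\<close>.\<close>

lemma bounded_linear_functional_nonzero:
  fixes x :: "'a::real_normed_vector"
  assumes "x \<noteq> 0"
  obtains u :: "'a \<Rightarrow> real" where "bounded_linear u" "u x \<noteq> 0"
proof -
  have "sublinear (norm :: 'a \<Rightarrow> real)"
    by (auto simp: sublinear_def norm_triangle_ineq)
  then obtain q where q: "sublinear q" "q \<le> norm" "q (- x) \<le> - norm x"
    by (rule sublinear_directional)
  obtain u where u: "linear u" "u \<le> q"
    using Hahn_Banach_sublinear[OF q(1)] .
  have u_le: "u y \<le> norm y" for y
    using u q by (meson le_fun_def order_trans)
  have "norm (u y) \<le> norm y * 1" for y
    using u_le[of y] u_le[of "- y"] linear_neg[OF u(1), of y] by auto
  then have "bounded_linear u"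
    using u(1) by (intro bounded_linear_intro[where K = 1]) (simp_all add: linear_add linear_scale)
  moreover have "u x \<noteq> 0"
  proof -
    have "u (- x) \<le> - norm x"
      using u(2) q(3) by (meson le_fun_def order_trans)
    then show ?thesis
      using assms linear_neg[OF u(1), of x] by auto
  qed
  ultimately show thesis
    by (rule that)
qed

section \<open>The scalar field: internal structure and compactness\<close>

text \<open>Replaces the isomorphism by a description inside \<open>'f\<close>. The link is that
  \<open>\<phi>\<close> fixes the real numbers, although it is not assumed to be real
  linear.\<close>

lemma real_or_complex_cases:
  obtains (real) "\<And>c :: 'f::real_or_complex. \<exists>a. c = of_real a"
  | (complex) i :: "'f::real_or_complex"
      where "i * i = - 1" "\<And>c. \<exists>a b. c = of_real a + of_real b * i"
proof -
  note real_or_complex[where ?'a = 'f]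
  then show thesis
  proof (elim disjE exE conjE)
    fix \<phi> :: "'f \<Rightarrow> real"
    assume "bij \<phi>" and add: "\<forall>a b. \<phi> (a + b) = \<phi> a + \<phi> b"
      and mult: "\<forall>a b. \<phi> (a * b) = \<phi> a * \<phi> b" and norm: "\<forall>a. norm (\<phi> a) = norm a"
    have inj: "\<phi> a = \<phi> b \<longleftrightarrow> a = b" for a b
      using \<open>bij \<phi>\<close> by (auto simp: bij_def inj_eq)
    have "\<phi> 1 \<noteq> 0"
      using norm[rule_format, of 1] by auto
    then have one: "\<phi> 1 = 1"
      using mult[rule_format, of 1 1] by simp
    \<comment> \<open>\<open>\<phi>\<close> maps \<open>of_real r\<close> to a real number at
      distance \<open>\<bar>r\<bar>\<close> from 0 and \<open>\<bar>r - 1\<bar>\<close> from 1, and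
      only \<open>r\<close> has both distances.\<close>
    have of_real: "\<phi> (of_real r) = r" for r
    proof -
      have "\<phi> (of_real r) = \<phi> (of_real (r - 1)) + 1"
        using add[rule_format, of "of_real (r - 1)" 1] one by simp
      moreover have "\<bar>\<phi> (of_real r)\<bar> = \<bar>r\<bar>" "\<bar>\<phi> (of_real (r - 1))\<bar> = \<bar>r - 1\<bar>"
        using norm norm_of_real by (metis real_norm_def)+
      ultimately show ?thesis
        by linarith
    qed
    have "c = of_real (\<phi> c)" for c
      by (rule inj[THEN iffD1]) (simp only: of_real)
    then show thesis
      using real by blast
  next
    fix \<phi> :: "'f \<Rightarrow> complex"
    assume "bij \<phi>" and add: "\<forall>a b. \<phi> (a + b) = \<phi> a + \<phi> b"
      and mult: "\<forall>a b. \<phi> (a * b) = \<phi> a * \<phi> b" and norm: "\<forall>a. norm (\<phi> a) = norm a"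
    have inj: "\<phi> a = \<phi> b \<Longrightarrow> a = b" for a b
      using \<open>bij \<phi>\<close> by (auto simp: bij_def inj_eq)
    have "\<phi> 1 \<noteq> 0"
      using norm[rule_format, of 1] by auto
    then have one: "\<phi> 1 = 1"
      using mult[rule_format, of 1 1] by simp
    have real: "\<phi> (of_real r) = of_real r" for r
    proof -
      \<comment> \<open>the distances from 0 and from 1 determine a real number among all complex numbers\<close>
      define z where "z = \<phi> (of_real r)"
      have "z - 1 = \<phi> (of_real (r - 1))"
        using add[rule_format, of "of_real (r - 1)" 1] one by (simp add: z_def)
      then have "norm z = \<bar>r\<bar>" "norm (z - 1) = \<bar>r - 1\<bar>"
        using norm by (simp_all add: z_def del: of_real_diff)
      then have *: "(Re z)\<^sup>2 + (Im z)\<^sup>2 = r\<^sup>2" "(Re z - 1)\<^sup>2 + (Im z)\<^sup>2 = (r - 1)\<^sup>2"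
        using cmod_power2[of z] cmod_power2[of "z - 1"] by simp_all
      then have "Re z = r"
        by (simp add: power2_diff)
      moreover have "Im z = 0"
        using * calculation by simp
      ultimately show ?thesis
        by (simp add: z_def complex_eq_iff)
    qed
    obtain i where i: "\<phi> i = \<i>"
      using \<open>bij \<phi>\<close> by (metis bij_pointE)
    have "\<phi> (i * i) = \<phi> (of_real (- 1))"
      using mult i real[of "- 1"] by simp
    then have "i * i = - 1"
      using inj by fastforce
    moreover have "\<exists>a b. c = of_real a + of_real b * i" for c
    proof -
      have "\<phi> c = \<phi> (of_real (Re (\<phi> c)) + of_real (Im (\<phi> c)) * i)"
        using add mult i real complex_eq[of "\<phi> c"] by (simp add: mult.commute)
      then show ?thesis
        using inj by blast
    qed
    ultimately show thesis
      by (rule complex)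
  qed
qed

text \<open>An additive norm-preserving map preserves distances, so Bolzano--Weierstrass in the
  target pulls back; surjectivity provides a preimage of the limit.\<close>

lemma convergent_subseq_if_isometry:
  fixes \<phi> :: "'f::real_normed_vector \<Rightarrow> 'b::{real_normed_vector,heine_borel}" and \<alpha> :: "nat \<Rightarrow> 'f"
  assumes "bij \<phi>" and add: "\<forall>a b. \<phi> (a + b) = \<phi> a + \<phi> b" and norm: "\<forall>a. norm (\<phi> a) = norm a"
    and "bounded (range \<alpha>)"
  obtains r :: "nat \<Rightarrow> nat" where "strict_mono r" "convergent (\<alpha> \<circ> r)"
proof -
  have diff: "norm (\<phi> a - \<phi> b) = norm (a - b)" for a b
    using add[rule_format, of "a - b" b] norm by (metis add_diff_cancel_right' diff_add_cancel)
  have "bounded (range (\<lambda>k. \<phi> (\<alpha> k)))"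
    using assms norm by (auto simp: bounded_iff)
  then obtain r l where r: "strict_mono r" "((\<lambda>k. \<phi> (\<alpha> k)) \<circ> r) \<longlonglongrightarrow> l"
    using bounded_imp_convergent_subsequence by metis
  obtain a where a: "l = \<phi> a"
    using \<open>bij \<phi>\<close> by (metis bij_pointE)
  have "(\<alpha> \<circ> r) \<longlonglongrightarrow> a"
    using r(2) unfolding a LIMSEQ_iff by (simp add: diff)
  then show thesis
    using r(1) that by (auto simp: convergent_def)
qed

lemma real_or_complex_convergent_subseq:
  fixes \<alpha> :: "nat \<Rightarrow> 'f::real_or_complex"
  assumes "bounded (range \<alpha>)"
  obtains r :: "nat \<Rightarrow> nat" where "strict_mono r" "convergent (\<alpha> \<circ> r)"
  using real_or_complex[where ?'a = 'f]
proof (elim disjE exE conjE)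
  fix \<phi> :: "'f \<Rightarrow> real"
  assume "bij \<phi>" "\<forall>a b. \<phi> (a + b) = \<phi> a + \<phi> b" "\<forall>a. norm (\<phi> a) = norm a"
  from convergent_subseq_if_isometry[OF this assms] that show thesis
    by blast
next
  fix \<phi> :: "'f \<Rightarrow> complex"
  assume "bij \<phi>" "\<forall>a b. \<phi> (a + b) = \<phi> a + \<phi> b" "\<forall>a. norm (\<phi> a) = norm a"
  from convergent_subseq_if_isometry[OF this assms] that show thesis
    by blast
qed

section \<open>Functionals over the scalar field and their kernels\<close>

text \<open>The real-linear functional \<open>u\<close> is made linear over \<open>'f\<close>: by
  the embedding of the reals in the real case, by the classical complexification in the complex
  case.\<close>

lemma dual_space_nonzero:
  fixes smul :: "'f::real_or_complex \<Rightarrow> 'a::real_normed_vector \<Rightarrow> 'a"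
  assumes "normed_space_over smul" and "x \<noteq> 0"
  obtains f where "f \<in> dual_space smul" "f x \<noteq> 0"
proof -
  interpret normed_space_over smul
    by fact
  obtain u :: "'a \<Rightarrow> real" where u: "bounded_linear u" "u x \<noteq> 0"
    using bounded_linear_functional_nonzero[OF assms(2)] .
  interpret u: bounded_linear u
    by fact
  have vs: "vector_space_pair smul ((*) :: 'f \<Rightarrow> 'f \<Rightarrow> 'f)"
    by standard (simp_all add: algebra_simps)
  note result = that
  have intro: thesis
    if add: "\<And>y z. f (y + z) = f y + f z" and scale: "\<And>c y. f (smul c y) = c * f y"
      and K: "\<And>y. norm (f y) \<le> norm y * K" and "f x \<noteq> 0" for f :: "'a \<Rightarrow> 'f" and K
  proof (rule result)
    have "bounded_linear f"
      using add K scale[of "of_real _"]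
      by (intro bounded_linear_intro[where K = K]) (simp_all add: smul_of_real scaleR_conv_of_real)
    moreover have "Vector_Spaces.linear smul (*) f"
      using vs add scale
      by (simp add: Vector_Spaces.linear_iff vector_space_pair_def)
    ultimately show "f \<in> dual_space smul"
      by (simp add: dual_space_def)
  qed fact
  obtain K where K: "\<And>y. norm (u y) \<le> norm y * K"
    using u.bounded by blast
  show thesis
  proof (cases rule: real_or_complex_cases[where ?'f = 'f])
    case real
    show thesis
    proof (rule intro)
      show "(of_real (u (smul c y)) :: 'f) = c * of_real (u y)" for c y
        using real[of c] by (auto simp: smul_of_real u.scaleR)
    qed (use u K in \<open>auto simp: u.add\<close>)
  next
    case (complex i)
    \<comment> \<open>Over the complex numbers this is the complex-linear functional with real part
      \<open>u\<close>.\<close>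
    define f where "f y = of_real (u y) - i * of_real (u (smul i y))" for y
    show thesis
    proof (rule intro)
      show add: "f (y + z) = f y + f z" for y z
        by (simp add: f_def u.add scale_right_distrib algebra_simps)
      have r: "f (smul (of_real a) y) = of_real a * f y" for a y
      proof -
        have "smul i (smul (of_real a) y) = a *\<^sub>R smul i y"
          by (metis scale_left_commute smul_of_real)
        then show ?thesis
          by (simp add: f_def smul_of_real u.scaleR algebra_simps)
      qed
      have "f (smul i y) = i * f y" for y
      proof -
        have "smul i (smul i y) = - y"
          using complex(1) by simp
        moreover have "i * (i * w) = - w" for w
          using complex(1) by (metis mult.assoc mult_minus1)
        ultimately show ?thesis
          by (simp add: f_def u.neg right_diff_distrib)
      qed
      then show "f (smul c y) = c * f y" for c y
        using complex(2)[of c] add r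
        by (auto simp: scale_left_distrib algebra_simps simp flip: scale_scale)
      \<comment> \<open>The modulus of \<open>i\<close> is never computed; it stays in the
        constant.\<close>
      show "norm (f y) \<le> norm y * (K + norm i * norm i * K)" for y
      proof -
        have "norm (f y) \<le> norm (u y) + norm i * norm (u (smul i y))"
          unfolding f_def by (rule order_trans[OF norm_triangle_ineq4]) (simp add: norm_mult)
        also have "\<dots> \<le> norm y * K + norm i * (norm (smul i y) * K)"
          by (intro add_mono mult_left_mono K) auto
        finally show ?thesis
          by (simp add: norm_smul algebra_simps)
      qed
      \<comment> \<open>In place of taking real parts in \<open>'f\<close>, squaring
        \<open>u x = i * u (smul i x)\<close> gives a vanishing sum of two real squares.\<close>
      show "f x \<noteq> 0"
      proof
        assume "f x = 0"
        then have "of_real (u x) = i * of_real (u (smul i x))"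
          by (simp add: f_def)
        then have "(of_real (u x) :: 'f) * of_real (u x) =
            i * i * (of_real (u (smul i x)) * of_real (u (smul i x)))"
          by (simp add: algebra_simps)
        then have "(of_real (u x * u x + u (smul i x) * u (smul i x)) :: 'f) = 0"
          by (simp add: complex(1))
        then have "u x * u x + u (smul i x) * u (smul i x) = 0"
          by (simp only: of_real_eq_0_iff)
        then show False
          using u(2) by (simp add: sum_squares_eq_zero_iff)
      qed
    qed
  qed
qed

text \<open>Two distinct basis vectors suffice: either \<open>g\<close> kills \<open>c\<close>, or
  subtracting a suitable multiple of \<open>c\<close> from \<open>b\<close> gives a kernel vector,
  nonzero by independence.\<close>

lemma linear_kernel_nonzero:
  fixes smul :: "'f::real_or_complex \<Rightarrow> 'a::real_normed_vector \<Rightarrow> 'a"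
  assumes "dim_gt_1 smul" and g: "Vector_Spaces.linear smul (*) g"
  obtains x where "x \<noteq> 0" "g x = 0"
proof -
  interpret g: Vector_Spaces.linear smul "(*)" g
    by fact
  obtain B where B: "\<not> g.vs1.dependent B" "infinite B \<or> card B > 1"
    using assms(1) by (auto simp: dim_gt_1_def)
  have "\<not> is_singleton B" "B \<noteq> {}"
    using B(2) by (auto simp: is_singleton_altdef)
  then obtain b c where bc: "b \<in> B" "c \<in> B" "b \<noteq> c"
    by (metis all_not_in_conv is_singletonI')
  show thesis
  proof (cases "g c = 0")
    case True
    moreover have "c \<noteq> 0"
      using B(1) bc(2) g.vs1.dependent_zero by blast
    ultimately show thesis
      by (intro that)
  next
    case False
    define x where "x = b - smul (g b / g c) c"
    have "g x = 0"
      using False by (simp add: x_def g.diff g.scale)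
    moreover have "x \<noteq> 0"
    proof
      assume "x = 0"
      then have "b = smul (g b / g c) c"
        by (simp add: x_def)
      then have "b \<in> g.vs1.span (B - {b})"
        using bc by (metis DiffI g.vs1.span_base g.vs1.span_scale singletonD)
      then show False
        using B(1) bc(1) by (auto simp: g.vs1.dependent_def)
    qed
    ultimately show thesis
      by (intro that)
  qed
qed

section \<open>Subsequences of exponents\<close>

text \<open>If no later term exceeded \<open>n m\<close>, all values would be among the first ones
  or at most \<open>n m\<close>, finitely many. Both \<open>r\<close> and \<open>n \<circ> r\<close>
  increase, so scalars can be thinned out along with the exponents.\<close>

lemma infinite_range_strict_mono_subseq:
  fixes n :: "nat \<Rightarrow> nat"
  assumes "infinite (range n)"
  obtains r :: "nat \<Rightarrow> nat" where "strict_mono r" "strict_mono (n \<circ> r)"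
proof -
  have step: "\<exists>k>m. n m < n k" for m
  proof (rule ccontr)
    assume *: "\<not> (\<exists>k>m. n m < n k)"
    have "range n \<subseteq> n ` {..m} \<union> {..n m}"
    proof
      fix v
      assume "v \<in> range n"
      then obtain k where k: "v = n k"
        by blast
      show "v \<in> n ` {..m} \<union> {..n m}"
        using * k by (cases "k \<le> m") (auto simp: not_le not_less)
    qed
    then show False
      using assms finite_subset by blast
  qed
  obtain r where "\<And>i. r i < r (Suc i) \<and> n (r i) < n (r (Suc i))"
    using dependent_nat_choice[of "\<lambda>_ _. True" "\<lambda>_ k l. k < l \<and> n k < n l"] step by auto
  then show thesis
    by (intro that[of r]) (simp_all add: strict_mono_Suc_iff)
qed

lemma finite_range_constant_subseq:
  fixes n :: "nat \<Rightarrow> 'b"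
  assumes "finite (range n)"
  obtains r :: "nat \<Rightarrow> nat" and m where "strict_mono r" "\<And>k. n (r k) = m"
proof -
  obtain k0 where "infinite {k \<in> UNIV. n k = n k0}"
    using pigeonhole_infinite[of UNIV n] assms by auto
  then obtain r :: "nat \<Rightarrow> nat" where "strict_mono r" "\<And>k. r k \<in> {k \<in> UNIV. n k = n k0}"
    using infinite_enumerate by blast
  then show thesis
    by (intro that[of r "n k0"]) auto
qed

section \<open>Operators, functionals and approximating sequences\<close>

lemma bounded_operator_funpow:
  assumes "normed_space_over smul" "bounded_operator smul T"
  shows "bounded_operator smul (T ^^ n)"
proof (induction n)
  case 0
  interpret normed_space_over smul
    by fact
  show ?case
    using linear_id by (simp add: bounded_operator_def bounded_linear_ident id_def)
next
  case (Suc n)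
  then show ?case
    using assms(2) Vector_Spaces.linear_compose[of smul smul "T ^^ n" smul T]
      bounded_linear_compose[of T "T ^^ n"]
    by (simp add: bounded_operator_def comp_def)
qed

lemma dual_space_comp:
  assumes "f \<in> dual_space smul" "bounded_operator smul S"
  shows "f \<circ> S \<in> dual_space smul"
  using assms Vector_Spaces.linear_compose[of smul smul S "(*)" f] bounded_linear_compose[of f S]
  by (simp add: dual_space_def bounded_operator_def comp_def)

lemma dual_space_smul: "f \<in> dual_space smul \<Longrightarrow> f (smul c x) = c * f x"
  by (auto simp: dual_space_def Vector_Spaces.linear_iff)

lemma dual_space_separates:
  assumes "normed_space_over smul" and "\<And>f. f \<in> dual_space smul \<Longrightarrow> f x = f y"
  shows "x = y"
proof (rule ccontr)
  assume "x \<noteq> y"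
  then obtain f where f: "f \<in> dual_space smul" "f (x - y) \<noteq> 0"
    using dual_space_nonzero[OF assms(1), of "x - y"] by auto
  then show False
    using assms(2)[OF f(1)] bounded_linear.linear linear_diff by (fastforce simp: dual_space_def)
qed

text \<open>The line spanned by \<open>z\<close> is weakly sequentially closed: if
  \<open>z \<noteq> 0\<close>, a functional nonzero at \<open>z\<close> forces the scalars to
  converge, and separation of points identifies the limit.\<close>

lemma weakly_convergent_multiples:
  assumes "normed_space_over smul"
    and lim: "\<And>f. f \<in> dual_space smul \<Longrightarrow> (\<lambda>k. \<alpha> k * f z) \<longlonglongrightarrow> f x"
  obtains c where "x = smul c z"
proof -
  interpret normed_space_over smul
    by fact
  show thesis
  proof (cases "z = 0")
    case True
    have "x = 0"
    proof (rule dual_space_separates[OF assms(1)])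
      fix f
      assume f: "f \<in> dual_space smul"
      then have "f 0 = 0"
        using dual_space_smul[of f smul 0 0] by simp
      then show "f x = f 0"
        using lim[OF f] True LIMSEQ_unique[of "\<lambda>k. 0" "f x" 0] by simp
    qed
    then show thesis
      using that[of 0] by simp
  next
    case False
    then obtain f where f: "f \<in> dual_space smul" "f z \<noteq> 0"
      using dual_space_nonzero[OF assms(1)] by blast
    have "(\<lambda>k. \<alpha> k * f z / f z) \<longlonglongrightarrow> f x / f z"
      using lim[OF f(1)] f(2) by (intro tendsto_divide) auto
    then have \<alpha>: "\<alpha> \<longlonglongrightarrow> f x / f z"
      using f(2) by simp
    have "x = smul (f x / f z) z"
    proof (rule dual_space_separates[OF assms(1)])
      fix g
      assume g: "g \<in> dual_space smul"
      have "(\<lambda>k. \<alpha> k * g z) \<longlonglongrightarrow> f x / f z * g z"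
        using \<alpha> by (intro tendsto_mult) auto
      then show "g x = g (smul (f x / f z) z)"
        using lim[OF g] LIMSEQ_unique g by (auto simp: dual_space_smul)
    qed
    then show thesis
      by (rule that)
  qed
qed

lemma approximates_subseq:
  assumes "approximates smul T y x \<alpha> n" "strict_mono r"
  shows "approximates smul T y x (\<alpha> \<circ> r) (n \<circ> r)"
  unfolding approximates_def
proof (intro conjI ballI)
  show "admissible_exponents smul T y x (n \<circ> r)"
    using assms by (auto simp: approximates_def admissible_exponents_def intro: strict_mono_o)
  show "x \<noteq> 0 \<longrightarrow> (\<forall>k. (\<alpha> \<circ> r) k \<noteq> 0)"
    using assms(1) by (simp add: approximates_def)
  fix f
  assume "f \<in> dual_space smul"
  then have "(\<lambda>k. \<alpha> k * f ((T ^^ n k) y)) \<longlonglongrightarrow> f x"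
    using assms(1) by (simp add: approximates_def)
  from LIMSEQ_subseq_LIMSEQ[OF this assms(2)]
  show "(\<lambda>k. (\<alpha> \<circ> r) k * f ((T ^^ (n \<circ> r) k) y)) \<longlonglongrightarrow> f x"
    by (simp add: comp_def)
qed

text \<open>Dropping finitely many terms is enough: for a functional with
  \<open>f x \<noteq> 0\<close> the products, hence the scalars, are eventually nonzero.\<close>

lemma approximates_scalars_nonzero:
  assumes "normed_space_over smul" "admissible_exponents smul T y x n" "x \<noteq> 0"
    and lim: "\<And>f. f \<in> dual_space smul \<Longrightarrow> (\<lambda>k. \<alpha> k * f ((T ^^ n k) y)) \<longlonglongrightarrow> f x"
  obtains r :: "nat \<Rightarrow> nat" where "approximates smul T y x (\<alpha> \<circ> r) (n \<circ> r)"
proof -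
  obtain f where f: "f \<in> dual_space smul" "f x \<noteq> 0"
    using dual_space_nonzero[OF assms(1,3)] .
  have "eventually (\<lambda>k. \<alpha> k * f ((T ^^ n k) y) \<noteq> 0) sequentially"
    using tendsto_imp_eventually_ne[OF lim[OF f(1)] f(2)] .
  then obtain K where K: "\<And>k. K \<le> k \<Longrightarrow> \<alpha> k \<noteq> 0"
    unfolding eventually_sequentially by (metis mult_zero_left)
  define r where "r k = k + K" for k
  have r: "strict_mono r"
    by (simp add: r_def strict_mono_def)
  have "approximates smul T y x (\<alpha> \<circ> r) (n \<circ> r)"
    unfolding approximates_def
  proof (intro conjI ballI)
    show "admissible_exponents smul T y x (n \<circ> r)"
      using assms(2) r by (auto simp: admissible_exponents_def intro: strict_mono_o)
    show "x \<noteq> 0 \<longrightarrow> (\<forall>k. (\<alpha> \<circ> r) k \<noteq> 0)"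
      using K by (simp add: r_def)
    fix f
    assume "f \<in> dual_space smul"
    from LIMSEQ_subseq_LIMSEQ[OF lim[OF this] r]
    show "(\<lambda>k. (\<alpha> \<circ> r) k * f ((T ^^ (n \<circ> r) k) y)) \<longlonglongrightarrow> f x"
      by (simp add: comp_def)
  qed
  then show thesis
    by (rule that)
qed

text \<open>Passes from an arbitrary weakly convergent sequence in the orbit to the conventions for
  exponents and scalars. Finitely many exponents would give a constant subsequence and put
  \<open>x\<close> on the line spanned by some \<open>(T ^^ m) y\<close>, inside the orbit.\<close>

lemma approximates_outside_orbit:
  assumes "normed_space_over smul" "y \<in> wl_supercyclic_vectors smul T"
    and x: "x \<notin> projective_orbit smul T y"
  obtains \<alpha> n where "approximates smul T y x \<alpha> n"
proof -
  interpret normed_space_over smul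
    by fact
  \<comment> \<open>The zero scalar puts 0 in the orbit, so \<open>x\<close> is nonzero.\<close>
  have "smul 0 ((T ^^ 0) y) \<in> projective_orbit smul T y"
    unfolding projective_orbit_def by blast
  then have "x \<noteq> 0"
    using x by auto
  have "x \<in> weak_limit_set smul (projective_orbit smul T y)"
    using assms(2) by (simp add: wl_supercyclic_vectors_def)
  then obtain v where v: "range v \<subseteq> projective_orbit smul T y" "weakly_converges smul v x"
    by (auto simp: weak_limit_set_def)
  have "\<forall>k. \<exists>a m. v k = smul a ((T ^^ m) y)"
    using v(1) by (fastforce simp: projective_orbit_def)
  then obtain \<alpha> n where \<alpha>n: "\<And>k. v k = smul (\<alpha> k) ((T ^^ n k) y)"
    by metis
  have lim: "(\<lambda>k. \<alpha> k * f ((T ^^ n k) y)) \<longlonglongrightarrow> f x" if "f \<in> dual_space smul" for f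
    using v(2) that by (simp add: weakly_converges_def \<alpha>n dual_space_smul)
  have sub: "(\<lambda>k. \<alpha> (r k) * f ((T ^^ n (r k)) y)) \<longlonglongrightarrow> f x"
    if "f \<in> dual_space smul" "strict_mono r" for f r
    using LIMSEQ_subseq_LIMSEQ[OF lim[OF that(1)] that(2)] by (simp add: comp_def)
  have "infinite (range n)"
  proof
    assume "finite (range n)"
    from finite_range_constant_subseq[OF this]
    obtain r :: "nat \<Rightarrow> nat" and m where r: "strict_mono r" "\<And>k. n (r k) = m"
      by blast
    have "(\<lambda>k. \<alpha> (r k) * f ((T ^^ m) y)) \<longlonglongrightarrow> f x" if "f \<in> dual_space smul" for f
      using sub[OF that r(1)] r(2) by simp
    then obtain c where "x = smul c ((T ^^ m) y)"
      using weakly_convergent_multiples[OF assms(1), of "\<lambda>k. \<alpha> (r k)" "(T ^^ m) y" x] by blast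
    then show False
      using x by (auto simp: projective_orbit_def)
  qed
  then obtain r :: "nat \<Rightarrow> nat" where r: "strict_mono r" "strict_mono (n \<circ> r)"
    by (rule infinite_range_strict_mono_subseq)
  have "admissible_exponents smul T y x (n \<circ> r)"
    using r(2) by (simp add: admissible_exponents_def)
  moreover have "(\<lambda>k. (\<alpha> \<circ> r) k * f ((T ^^ (n \<circ> r) k) y)) \<longlonglongrightarrow> f x"
    if "f \<in> dual_space smul" for f
    using sub[OF that r(1)] by simp
  ultimately obtain r' where "approximates smul T y x ((\<alpha> \<circ> r) \<circ> r') ((n \<circ> r) \<circ> r')"
    using approximates_scalars_nonzero[OF assms(1) _ \<open>x \<noteq> 0\<close>] by blast
  then show thesis
    by (rule that)
qed

section \<open>The four assertions\<close>

lemma liminf_norm_posD: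
  fixes u :: "nat \<Rightarrow> 'b::real_normed_vector"
  assumes "liminf (\<lambda>n. ereal (norm (u n))) > 0"
  obtains d N where "d > 0" "\<And>n. N \<le> n \<Longrightarrow> d \<le> norm (u n)"
proof -
  obtain d where d: "0 < ereal d" "ereal d < liminf (\<lambda>n. ereal (norm (u n)))"
    using ereal_dense2[OF assms] by auto
  from less_LiminfD[OF d(2)] obtain N where "\<And>n. N \<le> n \<Longrightarrow> d < norm (u n)"
    unfolding eventually_sequentially by auto
  then show thesis
    using d(1) by (intro that[of d N]) (auto intro: less_imp_le)
qed

text \<open>In the orbit a constant sequence does. Outside it the products with \<open>f0\<close>
  converge, hence are bounded, and division by the eventual lower bound \<open>d\<close> of
  \<open>f0\<close> along the orbit bounds the scalars.\<close>

lemma bounded_approximation: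
  assumes ns: "normed_space_over smul" and y: "y \<in> wl_supercyclic_vectors smul T"
    and f0: "f0 \<in> dual_space smul" "liminf (\<lambda>n. ereal (norm (f0 ((T ^^ n) y)))) > 0"
  shows "\<exists>\<alpha> n. bounded (range \<alpha>) \<and> approximates smul T y x \<alpha> n"
proof (cases "x \<in> projective_orbit smul T y")
  case True
  then obtain c m where c: "x = smul c ((T ^^ m) y)"
    by (auto simp: projective_orbit_def)
  interpret normed_space_over smul
    by fact
  have "approximates smul T y x (\<lambda>_. c) (\<lambda>_. m)"
    using True by (auto simp: approximates_def admissible_exponents_def c dual_space_smul)
  then show ?thesis
    by (intro exI[of _ "\<lambda>_. c"] exI) auto
next
  case False
  then obtain \<alpha> n where app: "approximates smul T y x \<alpha> n"
    using approximates_outside_orbit[OF ns y] by blast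
  obtain d N where d: "d > 0" "\<And>n. N \<le> n \<Longrightarrow> d \<le> norm (f0 ((T ^^ n) y))"
    using liminf_norm_posD[OF f0(2)] by blast
  have "strict_mono n"
    using app False by (simp add: approximates_def admissible_exponents_def)
  then have le: "k \<le> n k" for k
    by (rule seq_suble)
  have "(\<lambda>k. \<alpha> k * f0 ((T ^^ n k) y)) \<longlonglongrightarrow> f0 x"
    using app f0(1) by (simp add: approximates_def)
  then obtain K where K: "\<And>k. norm (\<alpha> k * f0 ((T ^^ n k) y)) \<le> K"
    using convergent_imp_Bseq[OF convergentI] by (force elim: BseqE)
  \<comment> \<open>The bound \<open>d\<close> holds only from exponent \<open>N\<close> on; since
    \<open>k \<le> n k\<close>, dropping the first \<open>N\<close> terms reaches that
    range.\<close>
  define r where "r k = k + N" for k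
  have r: "strict_mono r"
    by (simp add: r_def strict_mono_def)
  have "norm (\<alpha> (r k)) \<le> K / d" for k
  proof -
    have "norm (\<alpha> (r k)) * d \<le> norm (\<alpha> (r k)) * norm (f0 ((T ^^ n (r k)) y))"
      using le[of "r k"] by (intro mult_left_mono d) (auto simp: r_def)
    also have "\<dots> \<le> K"
      using K[of "r k"] by (simp add: norm_mult)
    finally show ?thesis
      using d(1) by (simp add: field_simps)
  qed
  then have "bounded (range (\<alpha> \<circ> r))"
    by (auto simp: bounded_iff)
  then show ?thesis
    using approximates_subseq[OF app r] by blast
qed

text \<open>With \<open>a = 0\<close> the products would be a null sequence times a bounded one,
  since power boundedness bounds the orbit; this contradicts a functional nonzero at
  \<open>x\<close>. Once \<open>a \<noteq> 0\<close>, dividing by the scalars yields the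
  limit.\<close>

lemma power_bounded_limit_scalar:
  assumes ns: "normed_space_over smul" and T: "bounded_operator smul T" "power_bounded T"
    and "x \<noteq> 0" and app: "approximates smul T y x \<alpha> n" and a: "\<alpha> \<longlonglongrightarrow> a"
  shows "a \<noteq> 0" and "f \<in> dual_space smul \<Longrightarrow> (\<lambda>k. f ((T ^^ n k) y)) \<longlonglongrightarrow> f x / a"
proof -
  have lim: "(\<lambda>k. \<alpha> k * f ((T ^^ n k) y)) \<longlonglongrightarrow> f x" if "f \<in> dual_space smul" for f
    using app that by (simp add: approximates_def)
  obtain M where M: "\<And>n. onorm (T ^^ n) \<le> M"
    using T(2) by (auto simp: power_bounded_def bdd_above_def)
  have Ty: "norm ((T ^^ m) y) \<le> M * norm y" for m
  proof -
    have "norm ((T ^^ m) y) \<le> onorm (T ^^ m) * norm y"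
      using bounded_operator_funpow[OF ns T(1)] by (intro onorm) (simp add: bounded_operator_def)
    also have "\<dots> \<le> M * norm y"
      by (intro mult_right_mono M) auto
    finally show ?thesis .
  qed
  obtain g where g: "g \<in> dual_space smul" "g x \<noteq> 0"
    using dual_space_nonzero[OF ns \<open>x \<noteq> 0\<close>] .
  then obtain L where L: "L \<ge> 0" "\<And>z. norm (g z) \<le> norm z * L"
    using bounded_linear.nonneg_bounded by (auto simp: dual_space_def)
  show "a \<noteq> 0"
  proof
    assume "a = 0"
    have "norm (g ((T ^^ n k) y)) \<le> M * norm y * L" for k
      using L(2)[of "(T ^^ n k) y"] mult_right_mono[OF Ty[of "n k"] L(1)] by linarith
    then have "Bfun (\<lambda>k. g ((T ^^ n k) y)) sequentially"
      by (intro BfunI always_eventually allI)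
    moreover have "Zfun \<alpha> sequentially"
      using a \<open>a = 0\<close> by (simp add: tendsto_Zfun_iff)
    ultimately have "Zfun (\<lambda>k. \<alpha> k * g ((T ^^ n k) y)) sequentially"
      by (intro bounded_bilinear.Zfun_prod_Bfun[OF bounded_bilinear_mult])
    then have "(\<lambda>k. \<alpha> k * g ((T ^^ n k) y)) \<longlonglongrightarrow> 0"
      by (simp add: tendsto_Zfun_iff)
    then show False
      using lim[OF g(1)] g(2) LIMSEQ_unique by blast
  qed
  then show "(\<lambda>k. f ((T ^^ n k) y)) \<longlonglongrightarrow> f x / a" if "f \<in> dual_space smul" for f
  proof -
    have "(\<lambda>k. \<alpha> k * f ((T ^^ n k) y) / \<alpha> k) \<longlonglongrightarrow> f x / a"
      using lim[OF that] a \<open>a \<noteq> 0\<close> by (rule tendsto_divide)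
    \<comment> \<open>The convention on scalars allows cancelling \<open>\<alpha> k\<close> in every
      term.\<close>
    moreover have "\<alpha> k \<noteq> 0" for k
      using app \<open>x \<noteq> 0\<close> by (simp add: approximates_def)
    ultimately show ?thesis
      by simp
  qed
qed

lemma liminf_functional_orbit_eq_0:
  fixes smul :: "'f::real_or_complex \<Rightarrow> 'a::real_normed_vector \<Rightarrow> 'a"
  assumes ns: "normed_space_over smul" and "dim_gt_1 smul" and T: "bounded_operator smul T"
    and \<alpha>: "\<And>x. x \<noteq> 0 \<Longrightarrow> \<alpha> x \<noteq> 0"
    and reach: "\<And>x. \<exists>n. \<forall>f\<in>dual_space smul. convergent (\<lambda>k. f ((T ^^ n k) y)) \<and>
      \<alpha> x * lim (\<lambda>k. f ((T ^^ n k) y)) = f x"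
    and f: "f \<in> dual_space smul"
  shows "liminf (\<lambda>n. ereal (norm (f ((T ^^ n) y)))) = 0"
proof (rule ccontr)
  assume "liminf (\<lambda>n. ereal (norm (f ((T ^^ n) y)))) \<noteq> 0"
  moreover have "0 \<le> liminf (\<lambda>n. ereal (norm (f ((T ^^ n) y))))"
    by (intro Liminf_bounded) auto
  ultimately have "liminf (\<lambda>n. ereal (norm (f ((T ^^ n) y)))) > 0"
    by simp
  then obtain d N where d: "d > 0" "\<And>n. N \<le> n \<Longrightarrow> d \<le> norm (f ((T ^^ n) y))"
    using liminf_norm_posD[of "\<lambda>n. f ((T ^^ n) y)"] by blast
  interpret normed_space_over smul
    by fact
  \<comment> \<open>Composing with \<open>T ^^ N\<close> moves the lower bound to every exponent, so
    that even a constant sequence \<open>n\<close> is covered.\<close>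
  define g where "g = f \<circ> (T ^^ N)"
  have g: "g \<in> dual_space smul"
    unfolding g_def by (intro dual_space_comp f bounded_operator_funpow ns T)
  have g_ge: "d \<le> norm (g ((T ^^ m) y))" for m
    using d(2)[of "N + m"] by (simp add: g_def funpow_add)
  obtain x where x: "x \<noteq> 0" "g x = 0"
    using linear_kernel_nonzero[OF assms(2), of g] g by (auto simp: dual_space_def)
  obtain n :: "nat \<Rightarrow> nat" where lim: "convergent (\<lambda>k. g ((T ^^ n k) y))"
      "\<alpha> x * lim (\<lambda>k. g ((T ^^ n k) y)) = g x"
    using reach[of x] g by blast
  \<comment> \<open>\<open>\<alpha> x\<close> is nonzero and \<open>g x = 0\<close>, so the limit
    must vanish, against the lower bound \<open>d\<close>.\<close>
  have "lim (\<lambda>k. g ((T ^^ n k) y)) = 0"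
    using lim(2) x \<alpha>[OF x(1)] by simp
  then have "(\<lambda>k. g ((T ^^ n k) y)) \<longlonglongrightarrow> 0"
    using lim(1) by (simp add: convergent_LIMSEQ_iff)
  then have "(\<lambda>k. norm (g ((T ^^ n k) y))) \<longlonglongrightarrow> 0"
    by (rule tendsto_norm_zero)
  then have "d \<le> 0"
    using g_ge by (intro LIMSEQ_le_const) auto
  then show False
    using d(1) by simp
qed

theorem theorem4p1:
  fixes smul :: "'f::real_or_complex \<Rightarrow> 'a::real_normed_vector \<Rightarrow> 'a"
    and T :: "'a \<Rightarrow> 'a" and y :: 'a
  assumes "normed_space_over smul"
    and "separable_space (euclidean :: 'a topology)"
    and "dim_gt_1 smul"
    and "bounded_operator smul T"
    and "wl_supercyclic smul T"
    and "y \<in> wl_supercyclic_vectors smul T"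
  shows
    "((\<exists>f0\<in>dual_space smul. liminf (\<lambda>n. ereal (norm (f0 ((T ^^ n) y)))) > 0) \<longrightarrow>
        (\<forall>x. \<exists>\<alpha> n. bounded (range \<alpha>) \<and> approximates smul T y x \<alpha> n))
   \<and> (\<forall>x. (\<exists>\<alpha> n. bounded (range \<alpha>) \<and> approximates smul T y x \<alpha> n) \<longrightarrow>
        (\<exists>\<alpha> n. convergent \<alpha> \<and> approximates smul T y x \<alpha> n))
   \<and> (power_bounded T \<longrightarrow>
        (\<forall>x \<alpha> n a. x \<noteq> 0 \<and> approximates smul T y x \<alpha> n \<and> \<alpha> \<longlonglongrightarrow> a \<longrightarrow>
          a \<noteq> 0 \<and> (\<forall>f\<in>dual_space smul. convergent (\<lambda>k. f ((T ^^ n k) y)) \<and>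
            a * lim (\<lambda>k. f ((T ^^ n k) y)) = f x)))
   \<and> ((\<exists>\<alpha> :: 'a \<Rightarrow> 'f. (\<forall>x. x \<noteq> 0 \<longrightarrow> \<alpha> x \<noteq> 0) \<and>
          (\<forall>x. \<exists>n. admissible_exponents smul T y x n \<and>
            (\<forall>f\<in>dual_space smul. convergent (\<lambda>k. f ((T ^^ n k) y)) \<and>
              \<alpha> x * lim (\<lambda>k. f ((T ^^ n k) y)) = f x))) \<longrightarrow>
        (\<forall>f\<in>dual_space smul. liminf (\<lambda>n. ereal (norm (f ((T ^^ n) y)))) = 0))"
proof (intro conjI impI allI ballI)
  note ns = assms(1) and y = assms(6)
  show "\<exists>\<alpha> n. bounded (range \<alpha>) \<and> approximates smul T y x \<alpha> n"
    if "\<exists>f0\<in>dual_space smul. liminf (\<lambda>n. ereal (norm (f0 ((T ^^ n) y)))) > 0" for x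
    using that bounded_approximation[OF ns y] by blast
  \<comment> \<open>A bounded scalar sequence has a convergent subsequence, and the exponents are
    thinned along it.\<close>
  show "\<exists>\<alpha> n. convergent \<alpha> \<and> approximates smul T y x \<alpha> n"
    if "\<exists>\<alpha> n. bounded (range \<alpha>) \<and> approximates smul T y x \<alpha> n" for x
    using that real_or_complex_convergent_subseq approximates_subseq by metis
  fix x \<alpha> n a
  assume "power_bounded T" "x \<noteq> 0 \<and> approximates smul T y x \<alpha> n \<and> \<alpha> \<longlonglongrightarrow> a"
  then have *: "a \<noteq> 0"
      "\<And>f. f \<in> dual_space smul \<Longrightarrow> (\<lambda>k. f ((T ^^ n k) y)) \<longlonglongrightarrow> f x / a"
    using power_bounded_limit_scalar[OF ns assms(4)] by blast+
  show "a \<noteq> 0"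
    by fact
  fix f
  assume f: "f \<in> dual_space smul"
  show "convergent (\<lambda>k. f ((T ^^ n k) y))"
    using *(2)[OF f] by (rule convergentI)
  show "a * lim (\<lambda>k. f ((T ^^ n k) y)) = f x"
    using limI[OF *(2)[OF f]] *(1) by simp
next
  fix f
  assume "\<exists>\<alpha> :: 'a \<Rightarrow> 'f. (\<forall>x. x \<noteq> 0 \<longrightarrow> \<alpha> x \<noteq> 0) \<and>
          (\<forall>x. \<exists>n. admissible_exponents smul T y x n \<and>
            (\<forall>f\<in>dual_space smul. convergent (\<lambda>k. f ((T ^^ n k) y)) \<and>
              \<alpha> x * lim (\<lambda>k. f ((T ^^ n k) y)) = f x))"
    and f: "f \<in> dual_space smul"
  then obtain \<alpha> where nz: "\<forall>x. x \<noteq> 0 \<longrightarrow> \<alpha> x \<noteq> 0"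
    and reach: "\<forall>x. \<exists>n. admissible_exponents smul T y x n \<and>
            (\<forall>f\<in>dual_space smul. convergent (\<lambda>k. f ((T ^^ n k) y)) \<and>
              \<alpha> x * lim (\<lambda>k. f ((T ^^ n k) y)) = f x)"
    by (elim exE conjE)
  have "\<exists>n. \<forall>f\<in>dual_space smul. convergent (\<lambda>k. f ((T ^^ n k) y)) \<and>
      \<alpha> x * lim (\<lambda>k. f ((T ^^ n k) y)) = f x" for x
    using spec[OF reach, of x] by (elim exE conjE) (rule exI)
  then show "liminf (\<lambda>n. ereal (norm (f ((T ^^ n) y)))) = 0"
    using nz f by (intro liminf_functional_orbit_eq_0[OF assms(1,3,4), where \<alpha> = \<alpha>]) simp_all
qed

end
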